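(* Let $X,Y$ be compact ultrametric spaces and $p\in[1,\infty]$. Then $$d_{\mathrm{I},p}(X,Y)=\inf_{\varphi,\psi}\max\left(\mathrm{dis}_{\mathrm{I},p}(\varphi),\ \mathrm{dis}_{\mathrm{I},p}(\psi),\ \mathrm{codis}_{\mathrm{I},p}(\varphi,\psi)\right),$$ where the infimum is taken over all set maps $\varphi:X\to Y$ and $\psi:Y\to X$.
   Context: All metric spaces are nonempty. Convention $\frac1\infty=0$. For $a,b\ge 0$: $a\boxplus_p b=(a^p+b^p)^{1/p}$ for $p<\infty$, $a\boxplus_\infty b=\max(a,b)$. The asymmetric $p$-difference is $A_p(a,b)=0$ if $a\le b$; for $a>b$, $A_p(a,b)=(a^p-b^p)^{1/p}$ if $p<\infty$ and $A_\infty(a,b)=a$. For a compact ultrametric space $(X,u_X)$, the associated dendrogram $\theta_X$ assigns to $t\ge0$ the partition of $X$ into blocks $[x]^{\theta_X}_t=\{x':u_X(x,x')\le t\}$. For $\varepsilon>0$, $X$ and $Y$ (equivalently their dendrograms) are $(\varepsilon,p)$-interleaved if there exist set maps $\varphi:X\to Y$, $\psi:Y\to X$ such that for all $t\ge0$, $x\in X$, $y\in Y$: (1) $\varphi([x]^{\theta_X}_t)\subseteq[\varphi(x)]^{\theta_Y}_{t\boxplus_p\varepsilon}$ and $\psi([y]^{\theta_Y}_t)\subseteq[\psi(y)]^{\theta_X}_{t\boxplus_p\varepsilon}$; (2) $[x]^{\theta_X}_{t\boxplus_p\varepsilon\boxplus_p\varepsilon}=[\psi\circ\varphi(x)]^{\theta_X}_{t\boxplus_p\varepsilon\boxplus_p\varepsilon}$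 and $[y]^{\theta_Y}_{t\boxplus_p\varepsilon\boxplus_p\varepsilon}=[\varphi\circ\psi(y)]^{\theta_Y}_{t\boxplus_p\varepsilon\boxplus_p\varepsilon}$. The $p$-interleaving distance is $d_{\mathrm{I},p}(X,Y)=\inf\{\varepsilon>0: X,Y\text{ are }(\varepsilon,p)\text{-interleaved}\}$. For set maps $\varphi:X\to Y$ and $\psi:Y\to X$, $$\mathrm{dis}_{\mathrm{I},p}(\varphi)=\sup_{x,x'\in X}A_p\left(u_Y(\varphi(x),\varphi(x')),u_X(x,x')\right)$$ (similarly for $\psi$), and $$\mathrm{codis}_{\mathrm{I},p}(\varphi,\psi)=2^{-\frac1p}\max\left(\sup_{x\in X}u_X(x,\psi\circ\varphi(x)),\ \sup_{y\in Y}u_Y(y,\varphi\circ\psi(y))\right).$$ *)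

theory Defs
  imports "HOL-Analysis.Analysis"
begin

locale compact_ultrametric_space = Metric_space +
  assumes nonempty: "M \<noteq> {}"
    and ultrametric: "\<lbrakk>x \<in> M; y \<in> M; z \<in> M\<rbrakk> \<Longrightarrow> d x z \<le> max (d x y) (d y z)"
    and compact: "compact_space mtopology"

definition p_sum :: "ereal \<Rightarrow> real \<Rightarrow> real \<Rightarrow> real" where
  "p_sum p a b =
     (if p = \<infinity> then max a b
      else (a powr real_of_ereal p + b powr real_of_ereal p) powr (1 / real_of_ereal p))"

definition asym_p_diff :: "ereal \<Rightarrow> real \<Rightarrow> real \<Rightarrow> real" where
  "asym_p_diff p a b =
     (if a \<le> b then 0
      else if p = \<infinity> then a
      else (a powr real_of_ereal p - b powr real_of_ereal p) powr (1 / real_of_ereal p))"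

text \<open>The block containing \<open>x\<close> at level \<open>t\<close> of the dendrogram of the ultrametric space \<open>(X, u)\<close>.\<close>
definition dendrogram_block :: "'a set \<Rightarrow> ('a \<Rightarrow> 'a \<Rightarrow> real) \<Rightarrow> real \<Rightarrow> 'a \<Rightarrow> 'a set" where
  "dendrogram_block X u t x = {x' \<in> X. u x x' \<le> t}"

definition p_interleaved ::
  "ereal \<Rightarrow> real \<Rightarrow> 'a set \<Rightarrow> ('a \<Rightarrow> 'a \<Rightarrow> real) \<Rightarrow> 'b set \<Rightarrow> ('b \<Rightarrow> 'b \<Rightarrow> real) \<Rightarrow> bool" where
  "p_interleaved p \<epsilon> X uX Y uY \<longleftrightarrow>
     (\<exists>\<phi> \<in> X \<rightarrow> Y. \<exists>\<psi> \<in> Y \<rightarrow> X. \<forall>t\<ge>0. \<forall>x\<in>X. \<forall>y\<in>Y.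
        \<phi> ` dendrogram_block X uX t x \<subseteq> dendrogram_block Y uY (p_sum p t \<epsilon>) (\<phi> x) \<and>
        \<psi> ` dendrogram_block Y uY t y \<subseteq> dendrogram_block X uX (p_sum p t \<epsilon>) (\<psi> y) \<and>
        dendrogram_block X uX (p_sum p (p_sum p t \<epsilon>) \<epsilon>) x =
          dendrogram_block X uX (p_sum p (p_sum p t \<epsilon>) \<epsilon>) (\<psi> (\<phi> x)) \<and>
        dendrogram_block Y uY (p_sum p (p_sum p t \<epsilon>) \<epsilon>) y =
          dendrogram_block Y uY (p_sum p (p_sum p t \<epsilon>) \<epsilon>) (\<phi> (\<psi> y)))"

text \<open>Infima and suprema are taken in the extended reals, so that no boundedness side conditions
  are needed for them to be meaningful; for compact spaces all values are finite.\<close>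

definition p_interleaving_dist ::
  "ereal \<Rightarrow> 'a set \<Rightarrow> ('a \<Rightarrow> 'a \<Rightarrow> real) \<Rightarrow> 'b set \<Rightarrow> ('b \<Rightarrow> 'b \<Rightarrow> real) \<Rightarrow> ereal" where
  "p_interleaving_dist p X uX Y uY =
     (INF \<epsilon> \<in> {\<epsilon>. \<epsilon> > 0 \<and> p_interleaved p \<epsilon> X uX Y uY}. ereal \<epsilon>)"

definition p_distortion ::
  "ereal \<Rightarrow> 'a set \<Rightarrow> ('a \<Rightarrow> 'a \<Rightarrow> real) \<Rightarrow> ('b \<Rightarrow> 'b \<Rightarrow> real) \<Rightarrow> ('a \<Rightarrow> 'b) \<Rightarrow> ereal" where
  "p_distortion p X uX uY \<phi> =
     (SUP (x, x') \<in> X \<times> X. ereal (asym_p_diff p (uY (\<phi> x) (\<phi> x')) (uX x x')))"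

text \<open>In \<^typ>\<open>ereal\<close>, \<open>1 / \<infinity> = 0\<close>, so the factor is \<open>1\<close> for \<open>p = \<infinity>\<close>.\<close>
definition p_codistortion ::
  "ereal \<Rightarrow> 'a set \<Rightarrow> ('a \<Rightarrow> 'a \<Rightarrow> real) \<Rightarrow> 'b set \<Rightarrow> ('b \<Rightarrow> 'b \<Rightarrow> real) \<Rightarrow>
     ('a \<Rightarrow> 'b) \<Rightarrow> ('b \<Rightarrow> 'a) \<Rightarrow> ereal" where
  "p_codistortion p X uX Y uY \<phi> \<psi> =
     ereal (2 powr (- real_of_ereal (1 / p))) *
       max (SUP x \<in> X. ereal (uX x (\<psi> (\<phi> x)))) (SUP y \<in> Y. ereal (uY y (\<phi> (\<psi> y))))"

end

theory Submission
  imports Defs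
begin

text \<open>
  Fix \<open>\<epsilon> > 0\<close> and set maps \<open>\<phi>\<close>, \<open>\<psi>\<close>. Since the asymmetric \<open>p\<close>-difference is the residual of the
  \<open>p\<close>-sum, \<open>asym_p_diff p a b \<le> \<epsilon>\<close> holds iff \<open>a \<le> p_sum p b \<epsilon>\<close>; hence the block inclusions at all
  levels say exactly that both distortions are at most \<open>\<epsilon>\<close>. In an ultrametric space two blocks of
  radius \<open>r\<close> coincide iff their centres are at distance at most \<open>r\<close>, so the block equalities are
  strongest at level \<open>0\<close>, where the radius is \<open>2\<^bsup>1/p\<^esup> \<epsilon>\<close>; they say that the codistortion
  is at most \<open>\<epsilon>\<close>. Thus \<open>\<phi>\<close>, \<open>\<psi>\<close> form an \<open>(\<epsilon>, p)\<close>-interleaving iff the maximum of the three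
  quantities is at most \<open>\<epsilon>\<close>, and the two infima agree.
\<close>

lemma ereal_ge_1_cases:
  fixes p :: ereal
  assumes "1 \<le> p"
  obtains "p = \<infinity>" | r where "p = ereal r" "1 \<le> r"
  using assms by (cases p) auto

lemma p_sum_mono:
  assumes "1 \<le> p" "0 \<le> a" "a \<le> a'" "0 \<le> b"
  shows "p_sum p a b \<le> p_sum p a' b"
  using assms(1)
proof (cases rule: ereal_ge_1_cases)
  case 1
  then show ?thesis using assms by (auto simp: p_sum_def)
next
  case (2 r)
  then show ?thesis using assms
    by (auto simp: p_sum_def intro!: powr_mono2 add_nonneg_nonneg)
qed

lemma p_sum_nonneg: "0 \<le> b \<Longrightarrow> 0 \<le> p_sum p a b"
  by (auto simp: p_sum_def)

lemma p_sum_0_left: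
  assumes "1 \<le> p" "0 \<le> e"
  shows "p_sum p 0 e = e"
  using assms(1)
  by (cases rule: ereal_ge_1_cases) (use assms in \<open>auto simp: p_sum_def powr_powr\<close>)

text \<open>This is the radius of the block equalities at level \<open>0\<close>, whose factor is
  the inverse of the one in the codistortion. For \<open>p = \<infinity>\<close> the exponent is
  \<open>1 / \<infinity> = 0\<close>, so the factor is 1.\<close>

lemma p_sum_same:
  assumes "1 \<le> p" "0 \<le> e"
  shows "p_sum p e e = 2 powr real_of_ereal (1 / p) * e"
  using assms(1)
proof (cases rule: ereal_ge_1_cases)
  case 1
  then show ?thesis by (simp add: p_sum_def)
next
  case (2 r)
  then have "p_sum p e e = (2 * e powr r) powr (1 / r)"
    by (simp add: p_sum_def)
  also have "\<dots> = 2 powr (1 / r) * e"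
    using 2 assms by (simp add: powr_mult powr_powr)
  also have "1 / r = real_of_ereal (1 / p)"
    using 2 by (simp add: one_ereal_def)
  finally show ?thesis .
qed

text \<open>If \<open>a \<le> b\<close>, both sides are true. Otherwise, for finite
  \<open>p = r\<close>, taking \<open>r\<close>-th powers is strictly increasing on nonnegative
  reals and turns both sides into \<open>a powr r \<le> b powr r + e powr r\<close>; for
  \<open>p = \<infinity>\<close> both sides reduce to \<open>a \<le> e\<close>.\<close>

lemma asym_p_diff_le_iff:
  assumes "1 \<le> p" "0 \<le> a" "0 \<le> b" "0 \<le> e"
  shows "asym_p_diff p a b \<le> e \<longleftrightarrow> a \<le> p_sum p b e"
  using assms(1)
proof (cases rule: ereal_ge_1_cases)
  case 1
  then show ?thesis using assms by (auto simp: p_sum_def asym_p_diff_def)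
next
  case (2 r)
  have mono: "u powr r \<le> v powr r \<longleftrightarrow> u \<le> v" if "0 \<le> u" "0 \<le> v" for u v
    using 2 that powr_mono2[of r u v] powr_less_mono2[of r v u] by linarith
  have powr_le_iff: "u powr (1 / r) \<le> v \<longleftrightarrow> u \<le> v powr r"
    "v \<le> u powr (1 / r) \<longleftrightarrow> v powr r \<le> u"
    if "0 \<le> u" "0 \<le> v" for u v
    using 2 that mono[of "u powr (1 / r)" v] mono[of v "u powr (1 / r)"]
    by (simp_all add: powr_powr)
  have sum: "a \<le> p_sum p b e \<longleftrightarrow> a powr r \<le> b powr r + e powr r"
    using 2 assms powr_le_iff(2)[of "b powr r + e powr r" a] by (simp add: p_sum_def)
  show ?thesis
  proof (cases "a \<le> b")
    case True
    then have "a powr r \<le> b powr r + e powr r"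
      using mono[of a b] assms by (simp add: add_increasing2)
    with True sum show ?thesis using assms by (simp add: asym_p_diff_def)
  next
    case False
    then have "b powr r \<le> a powr r"
      using mono[of b a] assms by simp
    with False sum show ?thesis
      using 2 assms powr_le_iff(1)[of "a powr r - b powr r" e] by (auto simp: asym_p_diff_def)
  qed
qed

text \<open>Moves the factor of the codistortion to the other side without first showing that the
  suprema are finite.\<close>

lemma ereal_mult_le_ereal_iff:
  assumes "0 < c"
  shows "ereal c * z \<le> ereal e \<longleftrightarrow> z \<le> ereal (e / c)"
  using assms by (cases z) (auto simp: field_simps)

context compact_ultrametric_space
begin

text \<open>By the strong triangle inequality every point of a closed ball is a centre of
  it.\<close>

lemma dendrogram_block_eq_iff:
  assumes "x \<in> M" "x' \<in> M" "0 \<le> r"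
  shows "dendrogram_block M d r x = dendrogram_block M d r x' \<longleftrightarrow> d x x' \<le> r"
proof
  assume "dendrogram_block M d r x = dendrogram_block M d r x'"
  moreover have "x' \<in> dendrogram_block M d r x'"
    using assms by (simp add: dendrogram_block_def)
  ultimately show "d x x' \<le> r"
    by (auto simp: dendrogram_block_def)
next
  assume le: "d x x' \<le> r"
  have "d x z \<le> r \<longleftrightarrow> d x' z \<le> r" if "z \<in> M" for z
    using ultrametric[OF assms(1,2) that] ultrametric[OF assms(2,1) that] commute[of x x'] le
    by linarith
  then show "dendrogram_block M d r x = dendrogram_block M d r x'"
    by (auto simp: dendrogram_block_def)
qed

text \<open>Both sides amount to a bound on each pair of points. The inclusion at the level
  \<open>t = d x x'\<close> yields the bound for that pair; conversely, the bound extends to every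
  \<open>t \<ge> d x x'\<close> because \<open>p_sum\<close> is monotone in its first
  argument.\<close>

lemma block_images_subset_iff_p_distortion_le:
  assumes "1 \<le> p" "0 \<le> e" "\<phi> \<in> M \<rightarrow> Y" "\<And>y y'. 0 \<le> uY y y'"
  shows "(\<forall>t\<ge>0. \<forall>x\<in>M. \<phi> ` dendrogram_block M d t x
            \<subseteq> dendrogram_block Y uY (p_sum p t e) (\<phi> x))
         \<longleftrightarrow> p_distortion p M d uY \<phi> \<le> ereal e"
proof -
  have "p_distortion p M d uY \<phi> \<le> ereal e
        \<longleftrightarrow> (\<forall>x\<in>M. \<forall>x'\<in>M. uY (\<phi> x) (\<phi> x') \<le> p_sum p (d x x') e)"
    unfolding p_distortion_def SUP_le_iff
    by (simp add: asym_p_diff_le_iff assms(1,2,4))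
  also have "\<dots> \<longleftrightarrow> (\<forall>t\<ge>0. \<forall>x\<in>M. \<phi> ` dendrogram_block M d t x
            \<subseteq> dendrogram_block Y uY (p_sum p t e) (\<phi> x))"
    (is "?L \<longleftrightarrow> ?R")
  proof
    assume L: ?L
    show ?R
    proof (intro allI impI ballI image_subsetI)
      fix t x x' assume "x \<in> M" "x' \<in> dendrogram_block M d t x"
      then have "x' \<in> M" "uY (\<phi> x) (\<phi> x') \<le> p_sum p (d x x') e" "d x x' \<le> t"
        using L by (simp_all add: dendrogram_block_def)
      then show "\<phi> x' \<in> dendrogram_block Y uY (p_sum p t e) (\<phi> x)"
        using p_sum_mono[OF assms(1) nonneg _ assms(2), of x x' t] assms(3)
        by (auto simp: dendrogram_block_def)
    qed
  next
    assume R: ?R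
    show ?L
    proof (intro ballI)
      fix x x' assume "x \<in> M" "x' \<in> M"
      then show "uY (\<phi> x) (\<phi> x') \<le> p_sum p (d x x') e"
        using R[rule_format, of "d x x'" x] by (auto simp: dendrogram_block_def)
    qed
  qed
  finally show ?thesis ..
qed

lemma blocks_eq_iff_le:
  assumes "1 \<le> p" "0 \<le> e" "f \<in> M \<rightarrow> M"
  shows "(\<forall>t\<ge>0. \<forall>x\<in>M. dendrogram_block M d (p_sum p (p_sum p t e) e) x
            = dendrogram_block M d (p_sum p (p_sum p t e) e) (f x))
         \<longleftrightarrow> (\<forall>x\<in>M. d x (f x) \<le> 2 powr real_of_ereal (1 / p) * e)"
proof -
  \<comment> \<open>The radius grows with \<open>t\<close>, so the condition at \<open>t = 0\<close>
    implies all the others.\<close>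
  have "p_sum p (p_sum p 0 e) e \<le> p_sum p (p_sum p t e) e" if "0 \<le> t" for t
    using assms that by (intro p_sum_mono p_sum_nonneg) auto
  moreover have "dendrogram_block M d (p_sum p (p_sum p t e) e) x
        = dendrogram_block M d (p_sum p (p_sum p t e) e) (f x)
      \<longleftrightarrow> d x (f x) \<le> p_sum p (p_sum p t e) e" if "x \<in> M" for x t
    using assms that by (intro dendrogram_block_eq_iff p_sum_nonneg) auto
  ultimately have "(\<forall>t\<ge>0. \<forall>x\<in>M. dendrogram_block M d (p_sum p (p_sum p t e) e) x
            = dendrogram_block M d (p_sum p (p_sum p t e) e) (f x))
         \<longleftrightarrow> (\<forall>x\<in>M. d x (f x) \<le> p_sum p (p_sum p 0 e) e)"
    by (auto intro: order_trans)
  then show ?thesis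
    using assms by (simp add: p_sum_0_left p_sum_same)
qed

end

lemma p_codistortion_le_iff:
  "p_codistortion p X uX Y uY \<phi> \<psi> \<le> ereal e \<longleftrightarrow>
     (\<forall>x\<in>X. uX x (\<psi> (\<phi> x)) \<le> 2 powr real_of_ereal (1 / p) * e) \<and>
     (\<forall>y\<in>Y. uY y (\<phi> (\<psi> y)) \<le> 2 powr real_of_ereal (1 / p) * e)"
proof -
  have "e / 2 powr (- q) = 2 powr q * e" for q :: real
    by (simp add: powr_minus field_simps)
  then show ?thesis
    unfolding p_codistortion_def
    by (subst ereal_mult_le_ereal_iff) (simp_all add: SUP_le_iff)
qed

lemma p_interleaved_iff:
  assumes "compact_ultrametric_space X uX" "compact_ultrametric_space Y uY" "1 \<le> p" "0 \<le> e"
  shows "p_interleaved p e X uX Y uY \<longleftrightarrow>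
    (\<exists>\<phi> \<in> X \<rightarrow> Y. \<exists>\<psi> \<in> Y \<rightarrow> X.
       max (p_distortion p X uX uY \<phi>)
         (max (p_distortion p Y uY uX \<psi>) (p_codistortion p X uX Y uY \<phi> \<psi>)) \<le> ereal e)"
proof -
  interpret X: compact_ultrametric_space X uX by fact
  interpret Y: compact_ultrametric_space Y uY by fact
  \<comment> \<open>Interleaving quantifies over \<open>x\<close> and \<open>y\<close> jointly.
    Splitting it into four independent conditions requires both spaces to be nonempty, since
    otherwise the joint statement would be vacuous.\<close>
  have distrib: "(\<forall>t\<ge>0. \<forall>x\<in>X. \<forall>y\<in>Y. A t x \<and> B t y \<and> C t x \<and> D t y) \<longleftrightarrow>
      (\<forall>t\<ge>0. \<forall>x\<in>X. A t x) \<and> (\<forall>t\<ge>0. \<forall>y\<in>Y. B t y) \<and>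
      (\<forall>t\<ge>0. \<forall>x\<in>X. C t x) \<and> (\<forall>t\<ge>0. \<forall>y\<in>Y. D t y)" for A B C D :: "real \<Rightarrow> _ \<Rightarrow> bool"
    using X.nonempty Y.nonempty by blast
  show ?thesis
    unfolding p_interleaved_def distrib
  proof (intro bex_cong refl)
    fix \<phi> \<psi> assume maps: "\<phi> \<in> X \<rightarrow> Y" "\<psi> \<in> Y \<rightarrow> X"
    then have "(\<lambda>x. \<psi> (\<phi> x)) \<in> X \<rightarrow> X" "(\<lambda>y. \<phi> (\<psi> y)) \<in> Y \<rightarrow> Y"
      by auto
    note eqs = X.blocks_eq_iff_le[OF assms(3,4) this(1)] Y.blocks_eq_iff_le[OF assms(3,4) this(2)]
    note incls = X.block_images_subset_iff_p_distortion_le[OF assms(3,4) maps(1) Y.nonneg]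
      Y.block_images_subset_iff_p_distortion_le[OF assms(3,4) maps(2) X.nonneg]
    show "((\<forall>t\<ge>0. \<forall>x\<in>X. \<phi> ` dendrogram_block X uX t x
              \<subseteq> dendrogram_block Y uY (p_sum p t e) (\<phi> x)) \<and>
          (\<forall>t\<ge>0. \<forall>y\<in>Y. \<psi> ` dendrogram_block Y uY t y
              \<subseteq> dendrogram_block X uX (p_sum p t e) (\<psi> y)) \<and>
          (\<forall>t\<ge>0. \<forall>x\<in>X. dendrogram_block X uX (p_sum p (p_sum p t e) e) x
              = dendrogram_block X uX (p_sum p (p_sum p t e) e) (\<psi> (\<phi> x))) \<and>
          (\<forall>t\<ge>0. \<forall>y\<in>Y. dendrogram_block Y uY (p_sum p (p_sum p t e) e) y
              = dendrogram_block Y uY (p_sum p (p_sum p t e) e) (\<phi> (\<psi> y)))) \<longleftrightarrow>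
        max (p_distortion p X uX uY \<phi>)
         (max (p_distortion p Y uY uX \<psi>) (p_codistortion p X uX Y uY \<phi> \<psi>)) \<le> ereal e"
      unfolding eqs incls by (auto simp: p_codistortion_le_iff)
  qed
qed

text \<open>A supremum over the empty set would be \<open>-\<infinity>\<close> in
  \<open>ereal\<close>; a single nonnegative term, here at \<open>(x, x)\<close>, rules this
  out.\<close>

lemma p_distortion_nonneg:
  assumes "X \<noteq> {}" "\<And>y y'. 0 \<le> uY y y'"
  shows "0 \<le> p_distortion p X uX uY \<phi>"
proof -
  obtain x where "x \<in> X" using assms by blast
  then show ?thesis
    unfolding p_distortion_def
    by (intro SUP_upper2[of "(x, x)"]) (auto simp: asym_p_diff_def assms(2))
qed

theorem theorem6p14:
  fixes X :: "'a set" and uX :: "'a \<Rightarrow> 'a \<Rightarrow> real"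
    and Y :: "'b set" and uY :: "'b \<Rightarrow> 'b \<Rightarrow> real"
    and p :: ereal
  assumes "compact_ultrametric_space X uX"
    and "compact_ultrametric_space Y uY"
    and "1 \<le> p"
  shows "p_interleaving_dist p X uX Y uY =
    (INF (\<phi>, \<psi>) \<in> (X \<rightarrow> Y) \<times> (Y \<rightarrow> X).
       max (p_distortion p X uX uY \<phi>)
         (max (p_distortion p Y uY uX \<psi>) (p_codistortion p X uX Y uY \<phi> \<psi>)))"
proof -
  define F where "F \<phi> \<psi> = max (p_distortion p X uX uY \<phi>)
    (max (p_distortion p Y uY uX \<psi>) (p_codistortion p X uX Y uY \<phi> \<psi>))" for \<phi> \<psi>
  have interleaved: "p_interleaved p e X uX Y uY \<longleftrightarrow>
      (\<exists>\<phi> \<in> X \<rightarrow> Y. \<exists>\<psi> \<in> Y \<rightarrow> X. F \<phi> \<psi> \<le> ereal e)" if "0 < e" for e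
    using p_interleaved_iff[OF assms] that by (simp add: F_def)
  have F_nonneg: "0 \<le> F \<phi> \<psi>" for \<phi> \<psi>
    unfolding F_def
    by (rule max.coboundedI1, rule p_distortion_nonneg)
      (use assms in \<open>auto simp: compact_ultrametric_space.nonempty
        intro: Metric_space.nonneg compact_ultrametric_space.axioms(1)\<close>)
  have "p_interleaving_dist p X uX Y uY = (INF (\<phi>, \<psi>) \<in> (X \<rightarrow> Y) \<times> (Y \<rightarrow> X). F \<phi> \<psi>)"
    unfolding p_interleaving_dist_def
  proof (rule antisym)
    show "(INF \<epsilon> \<in> {\<epsilon>. \<epsilon> > 0 \<and> p_interleaved p \<epsilon> X uX Y uY}. ereal \<epsilon>)
        \<le> (INF (\<phi>, \<psi>) \<in> (X \<rightarrow> Y) \<times> (Y \<rightarrow> X). F \<phi> \<psi>)"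
    proof (rule INF_greatest, clarify)
      fix \<phi> \<psi> assume maps: "\<phi> \<in> X \<rightarrow> Y" "\<psi> \<in> Y \<rightarrow> X"
      show "(INF \<epsilon> \<in> {\<epsilon>. \<epsilon> > 0 \<and> p_interleaved p \<epsilon> X uX Y uY}. ereal \<epsilon>) \<le> F \<phi> \<psi>"
      \<comment> \<open>Comparing with real upper bounds \<open>e\<close> of
        \<open>F \<phi> \<psi>\<close> avoids a separate case for an infinite value.\<close>
      proof (rule ereal_le_real)
        fix e assume le: "F \<phi> \<psi> \<le> ereal e"
        show "(INF \<epsilon> \<in> {\<epsilon>. \<epsilon> > 0 \<and> p_interleaved p \<epsilon> X uX Y uY}. ereal \<epsilon>) \<le> ereal e"
        \<comment> \<open>The bound \<open>e\<close> may be 0, whereas interleaving parameters are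
          strictly positive; hence \<open>e + \<delta>\<close> is used and \<delta> is
          arbitrary.\<close>
        proof (rule ereal_le_epsilon2)
          fix \<delta> :: real assume "0 < \<delta>"
          moreover have "0 \<le> e"
            using order_trans[OF F_nonneg le] by simp
          moreover have "F \<phi> \<psi> \<le> ereal (e + \<delta>)"
            using le \<open>0 < \<delta>\<close> by (auto intro: order_trans)
          ultimately have "e + \<delta> \<in> {\<epsilon>. \<epsilon> > 0 \<and> p_interleaved p \<epsilon> X uX Y uY}"
            using maps interleaved[of "e + \<delta>"] by auto
          then show "(INF \<epsilon> \<in> {\<epsilon>. \<epsilon> > 0 \<and> p_interleaved p \<epsilon> X uX Y uY}. ereal \<epsilon>)
              \<le> ereal e + ereal \<delta>"
            by (auto intro: INF_lower2)
        qed
      qed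
    qed
    show "(INF (\<phi>, \<psi>) \<in> (X \<rightarrow> Y) \<times> (Y \<rightarrow> X). F \<phi> \<psi>)
        \<le> (INF \<epsilon> \<in> {\<epsilon>. \<epsilon> > 0 \<and> p_interleaved p \<epsilon> X uX Y uY}. ereal \<epsilon>)"
    \<comment> \<open>Each admissible parameter comes with a pair of maps whose value of
      \<open>F\<close> is at most that parameter.\<close>
    proof (rule INF_greatest)
      fix e assume "e \<in> {\<epsilon>. \<epsilon> > 0 \<and> p_interleaved p \<epsilon> X uX Y uY}"
      then obtain \<phi> \<psi> where "\<phi> \<in> X \<rightarrow> Y" "\<psi> \<in> Y \<rightarrow> X" "F \<phi> \<psi> \<le> ereal e"
        using interleaved by blast
      then show "(INF (\<phi>, \<psi>) \<in> (X \<rightarrow> Y) \<times> (Y \<rightarrow> X). F \<phi> \<psi>) \<le> ereal e"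
        by (intro INF_lower2[of "(\<phi>, \<psi>)"]) auto
    qed
  qed
  then show ?thesis
    by (simp add: F_def)
qed

end
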